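(* Let $\mathbf{G}$ be the adjacency matrix of a symmetric, unweighted network without self-links on the finite node set $N$ and let $\delta\in\big(0,\tfrac{1}{\lambda_{\max}(\mathbf{G})}\big)$. For any node set $A\subseteq N$ and node $i\notin A$, the expected message reception counts are $$\overrightarrow{n}_{iA}=\sum_{j\in A}m_{ij}^{\lnot\{i\}};\qquad \overleftarrow{n}_{iA}=\sum_{j\in A}m_{ij}^{\lnot A};\qquad \overleftrightarrow{n}_{iA}=\sum_{j\in A}m_{ij}^{\lnot(A\cup\{i\})}.$$ For the special case $A=\{j\}$ (writing $n_{ij}$ for $n_{i\{j\}}$), $$\overrightarrow{n}_{ij}=\frac{m_{ij}}{m_{ii}};\qquad \overleftarrow{n}_{ij}=\frac{m_{ij}}{m_{jj}};\qquad \overleftrightarrow{n}_{ij}=\frac{m_{ij}}{m_{ii}m_{jj}-(m_{ij})^2}.$$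
   Context: $N=\{1,\dots,n\}$; $\mathbf{G}=(g_{ij})$ is symmetric with $g_{ij}\in\{0,1\}$, $g_{ii}=0$. $\lambda_{\max}(\mathbf{G})$ is its spectral radius (if it is $0$, any $\delta>0$ is allowed). A walk is a node sequence $w=(i_0,\dots,i_K)$, $K\ge0$, with $g_{i_ki_{k+1}}=1$ for $k=0,\dots,K-1$; its length is $K$ (length-zero walks $(i)$ are allowed). $\mathcal{W}_{ij}$ is the set of walks with $i_0=i$, $i_K=j$. For $B\subseteq N$, $\mathcal{W}_{ij}(\lnot B)$ is the set of $w\in\mathcal{W}_{ij}$ with $i_k\notin B$ for all $k\in\{1,\dots,K-1\}$, and $\mathcal{W}_{ij}^{t}(\lnot B)$ is the subset of those of length $t$. For a set of walks $\mathcal{W}'$, $M[[\mathcal{W}';x]]=\sum_{t\ge0}c_tx^t$, where $c_t$ is the number of walks of length $t$ in $\mathcal{W}'$. Here $m_{ij}=M[[\mathcal{W}_{ij};\delta]]$ and $m_{ij}^{\lnot B}=M[[\mathcal{W}_{ij}(\lnot B);\delta]]$ denote the (convergent) real values of these series at $x=\delta$; thus $(m_{ij})=(\mathbf{I}-\delta\mathbf{G})^{-1}$. Expected numbers of times group $A$ receives a message from sender $i$ when, respectively, the sender, the recipients, or both do not retransmit: $$\overrightarrow{n}_{iA}:=\sum_{j\in A}\sum_{t=0}^{\infty}\delta^{t}|\mathcal{W}_{ij}^{t}(\lnot\{i\})|,\quad \overleftarrow{n}_{iA}:=\sum_{j\in A}\sum_{t=0}^{\infty}\delta^{t}|\mathcal{W}_{ij}^{t}(\lnot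 A)|,\quad \overleftrightarrow{n}_{iA}:=\sum_{j\in A}\sum_{t=0}^{\infty}\delta^{t}|\mathcal{W}_{ij}^{t}(\lnot(A\cup\{i\}))|.$$ *)

theory Defs
  imports
    "Jordan_Normal_Form.Spectral_Radius"
    "HOL-Analysis.FPS_Convergence"
begin

text \<open>The node set $N$ is rendered as \<open>{..<n}\<close>, the index set of an \<open>n \<times> n\<close> matrix.\<close>

definition is_network :: "nat \<Rightarrow> real mat \<Rightarrow> bool" where
  "is_network n G \<longleftrightarrow>
     G \<in> carrier_mat n n \<and>
     transpose_mat G = G \<and>
     (\<forall>i<n. \<forall>j<n. G $$ (i, j) \<in> {0, 1}) \<and>
     (\<forall>i<n. G $$ (i, i) = 0)"

definition lambda_max :: "real mat \<Rightarrow> real" where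
  "lambda_max G = spectral_radius (map_mat complex_of_real G)"

text \<open>As \<open>1 / 0 = 0\<close> in HOL, the interval \<open>(0, 1 / \<lambda>\<^sub>m\<^sub>a\<^sub>x)\<close> has to be read as
  \<open>(0, \<infinity>)\<close> explicitly when the spectral radius is zero.\<close>

definition admissible_delta :: "real mat \<Rightarrow> real \<Rightarrow> bool" where
  "admissible_delta G \<delta> \<longleftrightarrow> 0 < \<delta> \<and> (lambda_max G = 0 \<or> \<delta> < 1 / lambda_max G)"

text \<open>A walk $(i_0,\dots,i_K)$ is the non-empty list of its $K + 1$ nodes.\<close>

definition is_walk :: "real mat \<Rightarrow> nat list \<Rightarrow> bool" where
  "is_walk G w \<longleftrightarrow>
     w \<noteq> [] \<and> set w \<subseteq> {..<dim_row G} \<and>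
     (\<forall>k. Suc k < length w \<longrightarrow> G $$ (w ! k, w ! Suc k) = 1)"

definition walk_length :: "nat list \<Rightarrow> nat" where
  "walk_length w = length w - 1"

definition walks :: "real mat \<Rightarrow> nat \<Rightarrow> nat \<Rightarrow> nat list set" where
  "walks G i j = {w. is_walk G w \<and> hd w = i \<and> last w = j}"

text \<open>Only the interior nodes of a walk are required to avoid \<open>B\<close>; its endpoints may lie in \<open>B\<close>.\<close>

definition walks_avoiding :: "real mat \<Rightarrow> nat set \<Rightarrow> nat \<Rightarrow> nat \<Rightarrow> nat list set" where
  "walks_avoiding G B i j =
     {w \<in> walks G i j. \<forall>k. 1 \<le> k \<and> k < walk_length w \<longrightarrow> w ! k \<notin> B}"

definition walks_avoiding_of_length ::
    "real mat \<Rightarrow> nat set \<Rightarrow> nat \<Rightarrow> nat \<Rightarrow> nat \<Rightarrow> nat list set" where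
  "walks_avoiding_of_length G B i j t = {w \<in> walks_avoiding G B i j. walk_length w = t}"

definition walk_gf :: "nat list set \<Rightarrow> real fps" where
  "walk_gf W = Abs_fps (\<lambda>t. real (card {w \<in> W. walk_length w = t}))"

definition m_walks :: "real mat \<Rightarrow> real \<Rightarrow> nat \<Rightarrow> nat \<Rightarrow> real" where
  "m_walks G \<delta> i j = eval_fps (walk_gf (walks G i j)) \<delta>"

definition m_avoiding :: "real mat \<Rightarrow> real \<Rightarrow> nat set \<Rightarrow> nat \<Rightarrow> nat \<Rightarrow> real" where
  "m_avoiding G \<delta> B i j = eval_fps (walk_gf (walks_avoiding G B i j)) \<delta>"

definition n_sender :: "real mat \<Rightarrow> real \<Rightarrow> nat \<Rightarrow> nat set \<Rightarrow> real" where
  "n_sender G \<delta> i A =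
     (\<Sum>j\<in>A. \<Sum>t. \<delta> ^ t * real (card (walks_avoiding_of_length G {i} i j t)))"

definition n_recipients :: "real mat \<Rightarrow> real \<Rightarrow> nat \<Rightarrow> nat set \<Rightarrow> real" where
  "n_recipients G \<delta> i A =
     (\<Sum>j\<in>A. \<Sum>t. \<delta> ^ t * real (card (walks_avoiding_of_length G A i j t)))"

definition n_both :: "real mat \<Rightarrow> real \<Rightarrow> nat \<Rightarrow> nat set \<Rightarrow> real" where
  "n_both G \<delta> i A =
     (\<Sum>j\<in>A. \<Sum>t. \<delta> ^ t * real (card (walks_avoiding_of_length G (A \<union> {i}) i j t)))"

end

theory Submission
  imports Defs
begin

text \<open>
  Cutting a walk at its last visit to \<open>k\<close> gives, for \<open>k \<notin> B\<close> and \<open>j \<noteq> k\<close>,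
  \<open>m\<^bsub>ij\<^esub>\<^bsup>\<not>B\<^esup> = [i \<noteq> k] m\<^bsub>ij\<^esub>\<^bsup>\<not>(B\<union>{k})\<^esup> + m\<^bsub>ik\<^esub>\<^bsup>\<not>B\<^esup> m\<^bsub>kj\<^esub>\<^bsup>\<not>(B\<union>{k})\<^esup>\<close>.
  With reversal symmetry, the singleton formulas are instances of this identity with
  \<open>B = {}\<close> and \<open>B = {j}\<close>; the determinant \<open>m\<^sub>i\<^sub>i m\<^sub>j\<^sub>j - (m\<^sub>i\<^sub>j)\<^sup>2\<close> equals
  \<open>m\<^sub>j\<^sub>j m\<^bsub>ii\<^esub>\<^bsup>\<not>{j}\<^esup>\<close>, where both factors are at least 1 because they count the walk of length zero.
  For convergence, choose \<open>\<mu> > \<delta>\<close> with \<open>\<mu> \<lambda>\<^sub>m\<^sub>a\<^sub>x < 1\<close>: the powers of \<open>\<mu> G\<close> are bounded, so the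
  series are dominated by a geometric series of ratio \<open>\<delta> / \<mu>\<close>.
\<close>

section \<open>Walks as lists and their interior nodes\<close>

lemma is_walk_iff_successively:
  "is_walk G w \<longleftrightarrow>
     w \<noteq> [] \<and> set w \<subseteq> {..<dim_row G} \<and> successively (\<lambda>a b. G $$ (a, b) = 1) w"
  by (simp add: is_walk_def successively_conv_nth)

text \<open>Dropping both endpoints leaves \<open>butlast (tl w)\<close>, a form that behaves well
  under appending and reversal. For lists of at most two nodes it is empty and the index range is
  vacuous.\<close>

lemma interior_avoids_iff:
  "(\<forall>k. 1 \<le> k \<and> k < walk_length w \<longrightarrow> w ! k \<notin> B) \<longleftrightarrow> set (butlast (tl w)) \<inter> B = {}"
proof -
  have "set (butlast (tl w)) = (\<lambda>k. w ! Suc k) ` {..<length w - 2}"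
  proof -
    have "butlast (tl w) ! k = w ! Suc k" if "k < length w - 2" for k
      using that by (simp add: nth_butlast nth_tl)
    moreover have "set (butlast (tl w)) = (!) (butlast (tl w)) ` {..<length w - 2}"
      by (simp add: set_conv_nth image_def Bex_def conj_commute)
         (auto simp: numeral_2_eq_2)
    ultimately show ?thesis by simp
  qed
  then have "set (butlast (tl w)) \<inter> B = {} \<longleftrightarrow> (\<forall>k < length w - 2. w ! Suc k \<notin> B)"
    by auto
  also have "\<dots> \<longleftrightarrow> (\<forall>k. 1 \<le> k \<and> k < walk_length w \<longrightarrow> w ! k \<notin> B)"
  proof (intro iffI allI impI)
    fix k assume *: "\<forall>k < length w - 2. w ! Suc k \<notin> B" and k: "1 \<le> k \<and> k < walk_length w"
    then have "k - 1 < length w - 2" by (auto simp: walk_length_def)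
    with k show "w ! k \<notin> B" using *[rule_format, of "k - 1"] by simp
  next
    fix k assume *: "\<forall>k. 1 \<le> k \<and> k < walk_length w \<longrightarrow> w ! k \<notin> B" and "k < length w - 2"
    then show "w ! Suc k \<notin> B" by (simp add: walk_length_def)
  qed
  finally show ?thesis by simp
qed

lemma mem_walks_avoiding_of_length:
  "w \<in> walks_avoiding_of_length G B i j t \<longleftrightarrow>
     length w = Suc t \<and> set w \<subseteq> {..<dim_row G} \<and> successively (\<lambda>a b. G $$ (a, b) = 1) w \<and>
     hd w = i \<and> last w = j \<and> set (butlast (tl w)) \<inter> B = {}"
  unfolding walks_avoiding_of_length_def walks_avoiding_def walks_def interior_avoids_iff
  by (cases w) (auto simp: is_walk_iff_successively walk_length_def)

lemma finite_walks_avoiding_of_length: "finite (walks_avoiding_of_length G B i j t)"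
  by (rule finite_subset[OF _ finite_lists_length_eq[of "{..<dim_row G}" "Suc t"]])
     (auto simp: mem_walks_avoiding_of_length)

lemma walks_avoiding_empty: "walks_avoiding G {} i j = walks G i j"
  by (auto simp: walks_avoiding_def)

lemma fps_nth_walk_gf_avoiding:
  "fps_nth (walk_gf (walks_avoiding G B i j)) t = real (card (walks_avoiding_of_length G B i j t))"
  by (simp add: walk_gf_def walks_avoiding_of_length_def)

lemma m_avoiding_eq_suminf:
  "m_avoiding G \<delta> B i j = (\<Sum>t. \<delta> ^ t * real (card (walks_avoiding_of_length G B i j t)))"
  by (simp add: m_avoiding_def eval_fps_def fps_nth_walk_gf_avoiding mult.commute)

section \<open>Cutting a walk at its last visit to a node\<close>

text \<open>The node \<open>k\<close> ends the first piece and starts the second. Since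
  \<open>k\<close> may be interior to the joined walk, it must lie outside \<open>B\<close>. In the
  second piece, avoiding \<open>k\<close> in the interior amounts to never returning to
  \<open>k\<close>, because the end \<open>j\<close> differs from \<open>k\<close>. The first piece
  may pass through \<open>k\<close> freely.\<close>

lemma split_walk_at_last_visit:
  assumes "k \<notin> B" "j \<noteq> k"
  shows "us @ k # vs \<in> walks_avoiding_of_length G B i j t \<and> k \<notin> set vs \<longleftrightarrow>
    length us \<le> t \<and> us @ [k] \<in> walks_avoiding_of_length G B i k (length us) \<and>
    k # vs \<in> walks_avoiding_of_length G (insert k B) k j (t - length us)"
\<comment> \<open>If \<open>vs\<close> is empty, both sides are false, as the last node would be
  \<open>k\<close> and not \<open>j\<close>. Otherwise splitting off the last node of
  \<open>vs\<close> exposes the interior.\<close>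
proof (cases vs rule: rev_cases)
  case Nil
  then show ?thesis using assms by (auto simp: mem_walks_avoiding_of_length)
next
  case (snoc ws x)
  then show ?thesis using assms
    by (cases us)
       (auto simp: mem_walks_avoiding_of_length successively_append_iff butlast_append
          successively_Cons hd_append split: if_splits)
qed

text \<open>A walk from \<open>k\<close> visits \<open>k\<close> at once. If \<open>i\<close>
  differs from \<open>k\<close>, then so do both endpoints, and only the interior matters.\<close>

lemma walks_not_visiting:
  assumes "j \<noteq> k"
  shows "{w \<in> walks_avoiding_of_length G B i j t. k \<notin> set w} =
    (if i = k then {} else walks_avoiding_of_length G (insert k B) i j t)"
proof -
  have "k \<in> set w \<longleftrightarrow> k \<in> {hd w, last w} \<union> set (butlast (tl w))" if "length w = Suc t" for w
    using that by (cases w; cases "tl w" rule: rev_cases) auto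
  then show ?thesis using assms
    by (auto simp: mem_walks_avoiding_of_length)
qed

lemma card_walks_visiting:
  assumes "k \<notin> B" "j \<noteq> k"
  shows "card {w \<in> walks_avoiding_of_length G B i j t. k \<in> set w} =
    (\<Sum>s\<le>t. card (walks_avoiding_of_length G B i k s) *
      card (walks_avoiding_of_length G (insert k B) k j (t - s)))"
proof -
  let ?W = "walks_avoiding_of_length G"
  let ?D = "SIGMA s:{..t}. ?W B i k s \<times> ?W (insert k B) k j (t - s)"
  let ?E = "{(us, vs). us @ k # vs \<in> ?W B i j t \<and> k \<notin> set vs}"
  \<comment> \<open>The condition \<open>k \<notin> set vs\<close> makes the cut the last visit,
    hence unique; \<open>split_list_last\<close> provides its existence.\<close>
  have "bij_betw (\<lambda>(us, vs). us @ k # vs) ?E {w \<in> ?W B i j t. k \<in> set w}"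
    unfolding bij_betw_def
  proof
    show "inj_on (\<lambda>(us, vs). us @ k # vs) ?E"
    proof (rule inj_onI; clarify)
      fix us vs us' vs' assume *: "k \<notin> set vs" "k \<notin> set vs'" "us @ k # vs = us' @ k # vs'"
      then show "us = us' \<and> vs = vs'"
        by (auto simp: append_eq_append_conv2 Cons_eq_append_conv append_eq_Cons_conv)
    qed
    show "(\<lambda>(us, vs). us @ k # vs) ` ?E = {w \<in> ?W B i j t. k \<in> set w}"
      by (auto simp: image_iff dest: split_list_last)
  qed
  \<comment> \<open>The cut position \<open>length us\<close> indexes the disjoint union. As
    \<open>k\<close> is shared by both pieces, their lengths \<open>s\<close> and
    \<open>t - s\<close> add up to exactly \<open>t\<close>.\<close>
  moreover have "bij_betw (\<lambda>(us, vs). (length us, us @ [k], k # vs)) ?E ?D"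
    unfolding bij_betw_def
  proof
    show "inj_on (\<lambda>(us, vs). (length us, us @ [k], k # vs)) ?E" by (auto intro!: inj_onI)
    show "(\<lambda>(us, vs). (length us, us @ [k], k # vs)) ` ?E = ?D"
    proof (intro equalityI subsetI)
      fix x assume "x \<in> (\<lambda>(us, vs). (length us, us @ [k], k # vs)) ` ?E"
      then show "x \<in> ?D" using split_walk_at_last_visit[OF assms] by auto
    next
      fix x assume "x \<in> ?D"
      then obtain s u v where x: "x = (s, u, v)" "s \<le> t" "u \<in> ?W B i k s"
        "v \<in> ?W (insert k B) k j (t - s)" by auto
      obtain us where u: "u = us @ [k]"
        using x(3) by (cases u rule: rev_cases) (auto simp: mem_walks_avoiding_of_length)
      obtain vs where v: "v = k # vs"
        using x(4) by (cases v) (auto simp: mem_walks_avoiding_of_length)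
      have "s = length us" using x(3) u by (simp add: mem_walks_avoiding_of_length)
      then show "x \<in> (\<lambda>(us, vs). (length us, us @ [k], k # vs)) ` ?E"
        using split_walk_at_last_visit[OF assms] x u v by (auto intro!: rev_image_eqI[of "(us, vs)"])
    qed
  qed
  ultimately have "card {w \<in> ?W B i j t. k \<in> set w} = card ?D"
    by (metis (no_types, lifting) bij_betw_same_card)
  also have "\<dots> = (\<Sum>s\<le>t. card (?W B i k s) * card (?W (insert k B) k j (t - s)))"
    by (subst card_SigmaI) (auto simp: finite_walks_avoiding_of_length card_cartesian_product)
  finally show ?thesis .
qed

lemma card_walks_decompose_last_visit:
  assumes "k \<notin> B" "j \<noteq> k"
  shows "card (walks_avoiding_of_length G B i j t) =
    (if i = k then 0 else card (walks_avoiding_of_length G (insert k B) i j t)) +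
    (\<Sum>s\<le>t. card (walks_avoiding_of_length G B i k s) *
      card (walks_avoiding_of_length G (insert k B) k j (t - s)))"
proof -
  let ?W = "walks_avoiding_of_length G B i j t"
  have "card ({w \<in> ?W. k \<notin> set w} \<union> {w \<in> ?W. k \<in> set w}) =
      card {w \<in> ?W. k \<notin> set w} + card {w \<in> ?W. k \<in> set w}"
    by (rule card_Un_disjoint) (auto simp: finite_walks_avoiding_of_length)
  moreover have "{w \<in> ?W. k \<notin> set w} \<union> {w \<in> ?W. k \<in> set w} = ?W" by blast
  ultimately have "card ?W = card {w \<in> ?W. k \<notin> set w} + card {w \<in> ?W. k \<in> set w}" by simp
  then show ?thesis
    unfolding card_walks_visiting[OF assms] walks_not_visiting[OF assms(2)] by simp
qed

text \<open>The sum over cut positions is a convolution, so the Cauchy product turns the identity of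
  coefficients into one of values; nonnegative terms make the convergence absolute.\<close>

lemma m_avoiding_decompose_last_visit:
  assumes summable: "\<And>B i j. summable (\<lambda>t. \<delta> ^ t * real (card (walks_avoiding_of_length G B i j t)))"
    and "k \<notin> B" "j \<noteq> k" "0 \<le> \<delta>"
  shows "m_avoiding G \<delta> B i j = (if i = k then 0 else m_avoiding G \<delta> (insert k B) i j) +
    m_avoiding G \<delta> B i k * m_avoiding G \<delta> (insert k B) k j"
proof -
  define c where "c B i j t = \<delta> ^ t * real (card (walks_avoiding_of_length G B i j t))" for B i j t
  have m: "m_avoiding G \<delta> B i j = suminf (c B i j)" for B i j
    by (simp add: m_avoiding_eq_suminf c_def[abs_def])
  have s: "summable (c B i j)" and sn: "summable (\<lambda>t. norm (c B i j t))" for B i j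
    using summable[of B i j] \<open>0 \<le> \<delta>\<close> by (simp_all add: c_def[abs_def])
  have "c B i j t = (if i = k then 0 else c (insert k B) i j t) +
      (\<Sum>s\<le>t. c B i k s * c (insert k B) k j (t - s))" for t
  proof -
    have *: "\<delta> ^ s * x * (\<delta> ^ (t - s) * y) = \<delta> ^ t * (x * y)" if "s \<le> t" for s and x y :: real
    proof -
      have "\<delta> ^ t = \<delta> ^ s * \<delta> ^ (t - s)" using that by (simp flip: power_add)
      then show ?thesis by (simp only: mult_ac)
    qed
    show ?thesis
      unfolding c_def card_walks_decompose_last_visit[OF assms(2,3)]
      by (auto simp: distrib_left sum_distrib_left * intro!: sum.cong)
  qed
  then have "c B i j = (\<lambda>t. (if i = k then 0 else c (insert k B) i j t) +
      (\<Sum>s\<le>t. c B i k s * c (insert k B) k j (t - s)))" by (rule ext)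
  moreover have "(\<lambda>t. if i = k then 0 else c (insert k B) i j t) sums
      (if i = k then 0 else suminf (c (insert k B) i j))"
    using s by (auto simp: summable_sums)
  note sums_add[OF this Cauchy_product_sums[OF sn sn, of B i k "insert k B" k j]]
  ultimately have "c B i j sums ((if i = k then 0 else suminf (c (insert k B) i j)) +
      suminf (c B i k) * suminf (c (insert k B) k j))"
    by (simp only:)
  then show ?thesis unfolding m by (simp add: sums_iff)
qed

section \<open>Reversal symmetry and the diagonal values\<close>

text \<open>Reversal swaps the endpoints and keeps the set of interior nodes. Symmetry of
  \<open>G\<close> reverses the links; it is used only at indices within range, where the nodes of a
  walk lie.\<close>

lemma rev_mem_walks_avoiding:
  assumes "transpose_mat G = G" "w \<in> walks_avoiding_of_length G B i j t"
  shows "rev w \<in> walks_avoiding_of_length G B j i t"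
proof -
  have sq: "dim_col G = dim_row G" using assms(1) by (metis index_transpose_mat(3))
  have sym: "G $$ (b, a) = G $$ (a, b)" if "a < dim_row G" "b < dim_row G" for a b
    using assms(1) that sq by (metis index_transpose_mat(1))
  have w: "w \<noteq> []" "set w \<subseteq> {..<dim_row G}" "successively (\<lambda>a b. G $$ (a, b) = 1) w"
    using assms(2) by (auto simp: mem_walks_avoiding_of_length)
  have "successively (\<lambda>a b. G $$ (b, a) = 1) w"
    by (rule successively_mono[OF w(3)]) (use w(2) sym in \<open>auto simp: subset_iff\<close>)
  moreover have "set (butlast (tl (rev w))) = set (butlast (tl w))"
    by (cases w; cases "tl w" rule: rev_cases) (auto simp: butlast_append)
  ultimately show ?thesis
    using assms(2) w by (auto simp: mem_walks_avoiding_of_length hd_rev last_rev)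
qed

lemma m_avoiding_commute:
  assumes "transpose_mat G = G"
  shows "m_avoiding G \<delta> B i j = m_avoiding G \<delta> B j i"
proof -
  have "bij_betw rev (walks_avoiding_of_length G B i j t) (walks_avoiding_of_length G B j i t)" for t
    by (rule bij_betw_byWitness[where f' = rev]) (auto intro: rev_mem_walks_avoiding[OF assms])
  then have "card (walks_avoiding_of_length G B i j t) = card (walks_avoiding_of_length G B j i t)" for t
    by (rule bij_betw_same_card)
  then show ?thesis by (simp add: m_avoiding_eq_suminf)
qed

text \<open>The walk \<open>[i]\<close> of length zero contributes 1, and all other terms are
  nonnegative. This keeps the denominators away from zero.\<close>

lemma m_avoiding_self_ge_1:
  assumes "summable (\<lambda>t. \<delta> ^ t * real (card (walks_avoiding_of_length G B i i t)))"
    and "0 \<le> \<delta>" "i < dim_row G"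
  shows "1 \<le> m_avoiding G \<delta> B i i"
proof -
  have "walks_avoiding_of_length G B i i 0 = {[i]}"
    using assms(3) by (auto simp: mem_walks_avoiding_of_length length_Suc_conv)
  then show ?thesis
    using sum_le_suminf[OF assms(1), of "{0}"] assms(2) by (simp add: m_avoiding_eq_suminf)
qed

section \<open>Convergence through bounded matrix powers\<close>

text \<open>Deleting the final node \<open>j\<close> leaves a walk to some neighbour
  \<open>l\<close> of \<open>j\<close>. An upper bound is enough to dominate the series.\<close>

lemma card_walks_Suc_le:
  "card (walks_avoiding_of_length G {} i j (Suc t)) \<le>
    (\<Sum>l | l < dim_row G \<and> G $$ (l, j) = 1. card (walks_avoiding_of_length G {} i l t))"
proof -
  let ?L = "{l. l < dim_row G \<and> G $$ (l, j) = 1}"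
  let ?W = "walks_avoiding_of_length G {}"
  have "?W i j (Suc t) \<subseteq> (\<Union>l\<in>?L. (\<lambda>w. w @ [j]) ` ?W i l t)"
  proof
    fix w assume w: "w \<in> ?W i j (Suc t)"
    then obtain u where u: "w = u @ [j]"
      by (cases w rule: rev_cases) (auto simp: mem_walks_avoiding_of_length)
    then obtain us l where "u = us @ [l]"
      using w by (cases u rule: rev_cases) (auto simp: mem_walks_avoiding_of_length)
    then have "l \<in> ?L" "u \<in> ?W i l t"
      using w u by (auto simp: mem_walks_avoiding_of_length successively_append_iff hd_append)
    then show "w \<in> (\<Union>l\<in>?L. (\<lambda>w. w @ [j]) ` ?W i l t)" using u by blast
  qed
  then have "card (?W i j (Suc t)) \<le> card (\<Union>l\<in>?L. (\<lambda>w. w @ [j]) ` ?W i l t)"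
    by (intro card_mono) (auto simp: finite_walks_avoiding_of_length)
  also have "\<dots> \<le> (\<Sum>l\<in>?L. card ((\<lambda>w. w @ [j]) ` ?W i l t))" by (rule card_UN_le) simp
  also have "\<dots> \<le> (\<Sum>l\<in>?L. card (?W i l t))"
    by (intro sum_mono card_image_le finite_walks_avoiding_of_length)
  finally show ?thesis .
qed

text \<open>The recursion over the last step of a walk mirrors multiplication by \<open>G\<close> on
  the right; the factor \<open>\<mu>\<close> is spread over the steps.\<close>

lemma card_walks_le_pow_mat:
  assumes "is_network n G" "0 \<le> \<mu>" "i < n" "j < n"
  shows "\<mu> ^ t * real (card (walks_avoiding_of_length G {} i j t)) \<le> ((\<mu> \<cdot>\<^sub>m G) ^\<^sub>m t) $$ (i, j)"
  using assms(4)
proof (induction t arbitrary: j)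
  case 0
  have "walks_avoiding_of_length G {} i j 0 \<subseteq> (if i = j then {[i]} else {})"
    by (auto simp: mem_walks_avoiding_of_length length_Suc_conv)
  then have "card (walks_avoiding_of_length G {} i j 0) \<le> card (if i = j then {[i]} else {})"
    by (intro card_mono) auto
  then show ?case using 0 assms by (auto simp: is_network_def split: if_splits)
next
  case (Suc t)
  have G: "G \<in> carrier_mat n n" and entries: "\<And>l. l < n \<Longrightarrow> G $$ (l, j) \<in> {0, 1}"
    using assms(1) Suc.prems by (auto simp: is_network_def)
  let ?R = "\<mu> \<cdot>\<^sub>m G"
  let ?c = "\<lambda>l. real (card (walks_avoiding_of_length G {} i l t))"
  have R: "?R ^\<^sub>m t \<in> carrier_mat n n" using G by simp
  have "real (card (walks_avoiding_of_length G {} i j (Suc t)))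
      \<le> (\<Sum>l | l < n \<and> G $$ (l, j) = 1. ?c l)"
    using card_walks_Suc_le[of G i j t] G by (simp flip: of_nat_sum)
  \<comment> \<open>Entries 0 and 1 act as the indicator of the neighbours of
    \<open>j\<close>.\<close>
  also have "\<dots> = (\<Sum>l<n. G $$ (l, j) * ?c l)"
  proof -
    have "(\<Sum>l<n. G $$ (l, j) * ?c l) = (\<Sum>l<n. if G $$ (l, j) = 1 then ?c l else 0)"
      by (rule sum.cong) (use entries in fastforce)+
    also have "\<dots> = (\<Sum>l\<in>{..<n} \<inter> {l. G $$ (l, j) = 1}. ?c l)" by (simp add: sum.If_cases)
    also have "{..<n} \<inter> {l. G $$ (l, j) = 1} = {l. l < n \<and> G $$ (l, j) = 1}" by auto
    finally show ?thesis by simp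
  qed
  finally have "\<mu> ^ Suc t * real (card (walks_avoiding_of_length G {} i j (Suc t)))
      \<le> \<mu> ^ Suc t * (\<Sum>l<n. G $$ (l, j) * ?c l)"
    using assms(2) by (intro mult_left_mono) auto
  also have "\<dots> = (\<Sum>l<n. (\<mu> ^ t * ?c l) * (\<mu> * G $$ (l, j)))"
    by (simp add: sum_distrib_left mult_ac)
  also have "\<dots> \<le> (\<Sum>l<n. (?R ^\<^sub>m t) $$ (i, l) * (\<mu> * G $$ (l, j)))"
  proof (intro sum_mono mult_right_mono)
    fix l assume "l \<in> {..<n}"
    then show "\<mu> ^ t * ?c l \<le> (?R ^\<^sub>m t) $$ (i, l)" "0 \<le> \<mu> * G $$ (l, j)"
      using Suc.IH[of l] entries[of l] assms(2) by auto
  qed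
  also have "\<dots> = (?R ^\<^sub>m Suc t) $$ (i, j)"
    using R G assms(3) Suc.prems by (simp add: scalar_prod_def lessThan_atLeast0)
  finally show ?case .
qed

text \<open>An eigenvector of \<open>c \<cdot>\<^sub>m A\<close> for \<open>k\<close> is one of
  \<open>A\<close> for \<open>k / c\<close>. It suffices to take \<open>k\<close> of maximal
  modulus, which exists because \<open>0 < n\<close>.\<close>

lemma spectral_radius_smult_less_1:
  assumes A: "A \<in> carrier_mat n n" and "0 < n" "c \<noteq> 0" and less: "norm c * spectral_radius A < 1"
  shows "spectral_radius (c \<cdot>\<^sub>m A) < 1"
proof -
  have cA: "c \<cdot>\<^sub>m A \<in> carrier_mat n n" using A by simp
  obtain k where k: "k \<in> spectrum (c \<cdot>\<^sub>m A)" "spectral_radius (c \<cdot>\<^sub>m A) = norm k"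
    using spectral_radius_mem_max(1)[OF cA \<open>0 < n\<close>] by blast
  then obtain v where v: "v \<in> carrier_vec n" "v \<noteq> 0\<^sub>v n" "(c \<cdot>\<^sub>m A) *\<^sub>v v = k \<cdot>\<^sub>v v"
    using A by (auto simp: spectrum_def eigenvalue_def eigenvector_def)
  have "A *\<^sub>v v = (k / c) \<cdot>\<^sub>v v"
  proof -
    have "c \<cdot>\<^sub>v (A *\<^sub>v v) = k \<cdot>\<^sub>v v"
    proof -
      have "(c \<cdot>\<^sub>m A) *\<^sub>v v = c \<cdot>\<^sub>v (A *\<^sub>v v)"
        using v(1) A by (intro eq_vecI) (auto simp: scalar_prod_def sum_distrib_left mult.assoc)
      then show ?thesis using v(3) by simp
    qed
    then have "(1 / c) \<cdot>\<^sub>v (c \<cdot>\<^sub>v (A *\<^sub>v v)) = (1 / c) \<cdot>\<^sub>v (k \<cdot>\<^sub>v v)" by simp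
    then show ?thesis using \<open>c \<noteq> 0\<close> by (simp add: smult_smult_assoc)
  qed
  then have "k / c \<in> spectrum A"
    using v A by (auto simp: spectrum_def eigenvalue_def eigenvector_def)
  then have "norm (k / c) \<le> spectral_radius A"
    using spectral_radius_mem_max(2)[OF A \<open>0 < n\<close>] by blast
  then show ?thesis
    using \<open>c \<noteq> 0\<close> less k(2) by (simp add: norm_divide field_simps)
qed

lemma walks_bounded_growth:
  assumes "is_network n G" "0 < n" "0 < \<mu>" "\<mu> * lambda_max G < 1"
  obtains C where "\<And>i j t. i < n \<Longrightarrow> j < n \<Longrightarrow>
    \<mu> ^ t * real (card (walks_avoiding_of_length G {} i j t)) \<le> C"
proof -
  let ?h = "map_mat complex_of_real"
  have G: "G \<in> carrier_mat n n" using assms(1) by (simp add: is_network_def)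
  have h: "?h (\<mu> \<cdot>\<^sub>m G) = complex_of_real \<mu> \<cdot>\<^sub>m ?h G" by (rule eq_matI) auto
  have "spectral_radius (?h (\<mu> \<cdot>\<^sub>m G)) < 1"
    unfolding h using assms G
    by (intro spectral_radius_smult_less_1[of _ n]) (auto simp: lambda_max_def)
  \<comment> \<open>Spectral radius below 1 bounds all powers entrywise by one constant, via the
    Jordan normal form.\<close>
  then obtain C where C: "\<And>k. norm_bound (?h (\<mu> \<cdot>\<^sub>m G) ^\<^sub>m k) C"
    using spectral_radius_jnf_norm_bound_less_1_upper_triangular[of "?h (\<mu> \<cdot>\<^sub>m G)" n] G by auto
  show ?thesis
  proof (rule that)
    fix i j t assume ij: "i < n" "j < n"
    have R: "(\<mu> \<cdot>\<^sub>m G) ^\<^sub>m t \<in> carrier_mat n n" using G by simp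
    have "norm_bound (?h ((\<mu> \<cdot>\<^sub>m G) ^\<^sub>m t)) C"
      using C[of t] G by (simp add: of_real_hom.mat_hom_pow[of _ n])
    then have "norm (complex_of_real (((\<mu> \<cdot>\<^sub>m G) ^\<^sub>m t) $$ (i, j))) \<le> C"
      using R ij unfolding norm_bound_def by (metis carrier_matD index_map_mat)
    then show "\<mu> ^ t * real (card (walks_avoiding_of_length G {} i j t)) \<le> C"
      using card_walks_le_pow_mat[OF assms(1) _ ij, of \<mu> t] assms(3) by simp
  qed
qed

lemma summable_walks_avoiding:
  assumes "is_network n G" "admissible_delta G \<delta>"
  shows "summable (\<lambda>t. \<delta> ^ t * real (card (walks_avoiding_of_length G B i j t)))"
proof (cases "i < n \<and> j < n")
  case True
  then have "0 < n" by simp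
  have G: "G \<in> carrier_mat n n" using assms(1) by (simp add: is_network_def)
  have \<delta>: "0 < \<delta>" using assms(2) by (simp add: admissible_delta_def)
  have "0 \<le> lambda_max G"
    using spectral_radius_mem_max(1)[of "map_mat complex_of_real G" n] G \<open>0 < n\<close>
    by (auto simp: lambda_max_def)
  \<comment> \<open>The slack between \<open>\<delta>\<close> and \<open>\<mu>\<close> yields the
    geometric ratio \<open>\<delta> / \<mu> < 1\<close>. For spectral radius 0, any larger
    \<open>\<mu>\<close> will do.\<close>
  then have "\<exists>\<mu>>\<delta>. \<mu> * lambda_max G < 1"
  proof (cases "lambda_max G = 0")
    case False
    then have "\<delta> < 1 / lambda_max G" using assms(2) by (auto simp: admissible_delta_def)
    then obtain \<mu> where "\<delta> < \<mu>" "\<mu> < 1 / lambda_max G" using dense by blast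
    then show ?thesis using \<open>0 \<le> lambda_max G\<close> False by (auto simp: field_simps)
  qed (auto intro: gt_ex)
  then obtain \<mu> where \<mu>: "\<delta> < \<mu>" "\<mu> * lambda_max G < 1" by blast
  obtain C where C: "\<mu> ^ t * real (card (walks_avoiding_of_length G {} i j t)) \<le> C" for t
    using walks_bounded_growth[OF assms(1) \<open>0 < n\<close> _ \<mu>(2)] \<delta> \<mu>(1) True
    by (metis order_less_trans)
  show ?thesis
  proof (rule summable_comparison_test')
    show "summable (\<lambda>t. C * (\<delta> / \<mu>) ^ t)"
      using \<delta> \<mu>(1) by (intro summable_mult summable_geometric) simp
    fix t :: nat
    have "card (walks_avoiding_of_length G B i j t) \<le> card (walks_avoiding_of_length G {} i j t)"
      by (intro card_mono finite_walks_avoiding_of_length) (auto simp: mem_walks_avoiding_of_length)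
    then have "\<delta> ^ t * real (card (walks_avoiding_of_length G B i j t))
        \<le> (\<mu> ^ t * real (card (walks_avoiding_of_length G {} i j t))) * (\<delta> / \<mu>) ^ t"
      using \<delta> \<mu>(1) by (simp add: power_divide)
    also have "\<dots> \<le> C * (\<delta> / \<mu>) ^ t" using C \<delta> \<mu>(1) by (intro mult_right_mono) auto
    finally show "norm (\<delta> ^ t * real (card (walks_avoiding_of_length G B i j t))) \<le> C * (\<delta> / \<mu>) ^ t"
      using \<delta> by simp
  qed
next
  \<comment> \<open>No walk has an endpoint outside the node set, so all terms vanish. Summability
    thus holds for all indices, as the decomposition lemma asks.\<close>
  case False
  have dim: "dim_row G = n" using assms(1) by (auto simp: is_network_def)
  have "walks_avoiding_of_length G B i j t = {}" for t
  proof (rule equals0I)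
    fix w assume w: "w \<in> walks_avoiding_of_length G B i j t"
    then have "w \<noteq> []" by (auto simp: mem_walks_avoiding_of_length)
    then show False
      using w False dim hd_in_set[of w] last_in_set[of w]
      by (auto simp: mem_walks_avoiding_of_length)
  qed
  then show ?thesis by simp
qed

text \<open>Summability and nonzero denominators are asserted alongside the formulas, since infinite
  sums and division are total in HOL and the equations alone would not express them.\<close>

theorem proposition3:
  fixes n :: nat and G :: "real mat" and \<delta> :: real
  assumes "is_network n G"
    and "admissible_delta G \<delta>"
  shows
    "(\<forall>i<n. \<forall>j<n.
        summable (\<lambda>t. fps_nth (walk_gf (walks G i j)) t * \<delta> ^ t) \<and>
        (\<forall>B \<subseteq> {..<n}. summable (\<lambda>t. fps_nth (walk_gf (walks_avoiding G B i j)) t * \<delta> ^ t))) \<and>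
     (\<forall>A \<subseteq> {..<n}. \<forall>i<n. i \<notin> A \<longrightarrow>
        n_sender G \<delta> i A = (\<Sum>j\<in>A. m_avoiding G \<delta> {i} i j) \<and>
        n_recipients G \<delta> i A = (\<Sum>j\<in>A. m_avoiding G \<delta> A i j) \<and>
        n_both G \<delta> i A = (\<Sum>j\<in>A. m_avoiding G \<delta> (A \<union> {i}) i j)) \<and>
     (\<forall>i<n. \<forall>j<n. i \<noteq> j \<longrightarrow>
        m_walks G \<delta> i i \<noteq> 0 \<and> m_walks G \<delta> j j \<noteq> 0 \<and>
        m_walks G \<delta> i i * m_walks G \<delta> j j - (m_walks G \<delta> i j)\<^sup>2 \<noteq> 0 \<and>
        n_sender G \<delta> i {j} = m_walks G \<delta> i j / m_walks G \<delta> i i \<and>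
        n_recipients G \<delta> i {j} = m_walks G \<delta> i j / m_walks G \<delta> j j \<and>
        n_both G \<delta> i {j} = m_walks G \<delta> i j / (m_walks G \<delta> i i * m_walks G \<delta> j j - (m_walks G \<delta> i j)\<^sup>2))"
proof -
  have sym: "transpose_mat G = G" and dim: "dim_row G = n" and \<delta>: "0 \<le> \<delta>"
    using assms by (auto simp: is_network_def admissible_delta_def)
  note summable = summable_walks_avoiding[OF assms]
  have gf: "summable (\<lambda>t. fps_nth (walk_gf (walks_avoiding G B i j)) t * \<delta> ^ t)" for B i j
    using summable[of B i j] by (simp add: fps_nth_walk_gf_avoiding mult.commute)
  let ?a = "m_avoiding G \<delta>"
  have m: "m_walks G \<delta> i j = ?a {} i j" for i j
    by (simp add: m_walks_def m_avoiding_def walks_avoiding_empty)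
  have dec: "?a B i j = (if i = k then 0 else ?a (insert k B) i j) + ?a B i k * ?a (insert k B) k j"
    if "k \<notin> B" "j \<noteq> k" for B i j k
    using m_avoiding_decompose_last_visit[OF summable that \<delta>] .
  have ge_1: "1 \<le> ?a B i i" if "i < n" for B i
    using m_avoiding_self_ge_1[OF summable \<delta>] that dim by simp
  have n: "n_sender G \<delta> i A = (\<Sum>j\<in>A. ?a {i} i j)" "n_recipients G \<delta> i A = (\<Sum>j\<in>A. ?a A i j)"
    "n_both G \<delta> i A = (\<Sum>j\<in>A. ?a (A \<union> {i}) i j)" for i A
    by (simp_all add: n_sender_def n_recipients_def n_both_def m_avoiding_eq_suminf)
  have single: "?a {} i i \<noteq> 0 \<and> ?a {} j j \<noteq> 0 \<and> ?a {} i i * ?a {} j j - (?a {} i j)\<^sup>2 \<noteq> 0 \<and>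
      ?a {i} i j = ?a {} i j / ?a {} i i \<and> ?a {j} i j = ?a {} i j / ?a {} j j \<and>
      ?a {i, j} i j = ?a {} i j / (?a {} i i * ?a {} j j - (?a {} i j)\<^sup>2)"
    if "i < n" "j < n" "i \<noteq> j" for i j
  proof -
    have nz: "?a {} i i \<noteq> 0" "?a {} j j \<noteq> 0" "?a {j} i i \<noteq> 0"
      using ge_1[of i "{}"] ge_1[of j "{}"] ge_1[of i "{j}"] that by auto
    \<comment> \<open>Cut at the last visit to the sender; the start is already such a visit, so the
      first summand vanishes.\<close>
    have sender: "?a {} i j = ?a {} i i * ?a {i} i j"
      using dec[of i "{}" j i] that by simp
    \<comment> \<open>The same cut for walks from \<open>j\<close> to \<open>i\<close>, read
      backwards.\<close>
    have recipient: "?a {} i j = ?a {} j j * ?a {j} i j"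
      using dec[of j "{}" i j] that m_avoiding_commute[OF sym] by simp
    \<comment> \<open>Closed walks at \<open>i\<close> either miss \<open>j\<close> or are cut at
      their last visit to \<open>j\<close>.\<close>
    have return: "?a {} i i = ?a {j} i i + ?a {} i j * ?a {j} i j"
      using dec[of j "{}" i i] that m_avoiding_commute[OF sym, of \<delta> "{j}" i j] by simp
    \<comment> \<open>Cut at the last visit to \<open>i\<close> with \<open>j\<close> already barred
      from the interior; \<open>j\<close> remains allowed as an endpoint.\<close>
    have both: "?a {j} i j = ?a {j} i i * ?a {i, j} i j"
      using dec[of i "{j}" j i] that by simp
    \<comment> \<open>Multiply \<open>return\<close> by \<open>?a {} j j\<close> and replace
      \<open>?a {} j j * ?a {j} i j\<close> by \<open>?a {} i j\<close>.\<close>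
    have det: "?a {} i i * ?a {} j j - (?a {} i j)\<^sup>2 = ?a {} j j * ?a {j} i i"
      using return recipient by (simp add: power2_eq_square algebra_simps)
    have "?a {} i j = ?a {} j j * ?a {j} i i * ?a {i, j} i j"
      using recipient both by simp
    then show ?thesis
      unfolding det using nz sender recipient by (simp add: nonzero_eq_divide_eq mult.commute)
  qed
  show ?thesis
    using gf[of "{}"] gf single unfolding m n walks_avoiding_empty by (simp add: insert_commute)
qed

end
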